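(* Let $0<p<\infty$ and let $w:\mathbb{D}\to(0,\infty)$ be a weight function such that $d\mu(z)=w(z)\,dA(z)$ is a finite positive measure on the unit disk $\mathbb{D}$. Suppose that for some non-negative integer $k$, some $r_0\in(0,1)$ and some constant $C$ we have $$r^k w\left(\frac{z}{r}\right)\le C\,w(z)\qquad\text{for all } r\in[r_0,1) \text{ and all } z \text{ with } |z|<r.$$ Then the polynomials are dense in the weighted Bergman space $A^p(\mathbb{D},d\mu)$.
   Context: $\mathbb{D}=\{z\in\mathbb{C}:|z|<1\}$ and $dA(z)=dx\,dy$ is planar Lebesgue measure. A weight function on $\mathbb{D}$ is a positive function on $\mathbb{D}$ integrable with respect to $dA$. For $0<p<\infty$, the weighted Bergman space $A^p(\mathbb{D},d\mu)=A^p(\mathbb{D},w\,dA)$ is the space of analytic functions $f$ on $\mathbb{D}$ with $\|f\|^p_{A^p(\mathbb{D},d\mu)}=\int_{\mathbb{D}}|f(z)|^p w(z)\,dA(z)<\infty$. Polynomials means analytic polynomials (in $z$, complex coefficients). Density means: for every $f$ in the space and every $\varepsilon>0$ there is a polynomial $Q$ with $\|f-Q\|_{A^p(\mathbb{D},d\mu)}<\varepsilon$. *)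

theory Defs
  imports "HOL-Analysis.Analysis" "HOL-Computational_Algebra.Polynomial"
begin

abbreviation unit_disk :: "complex set" where
  "unit_disk \<equiv> ball 0 1"

(* Functions on the disk are total functions on complex; their values off the disk play no role. *)
definition weight_function :: "(complex \<Rightarrow> real) \<Rightarrow> bool" where
  "weight_function w \<longleftrightarrow>
     (\<forall>z\<in>unit_disk. 0 < w z) \<and> integrable (lebesgue_on unit_disk) w"

definition weighted_measure :: "(complex \<Rightarrow> real) \<Rightarrow> complex measure" where
  "weighted_measure w = density (lebesgue_on unit_disk) (\<lambda>z. ennreal (w z))"

definition bergman_space :: "real \<Rightarrow> complex measure \<Rightarrow> (complex \<Rightarrow> complex) set" where
  "bergman_space p \<mu> =
     {f. f holomorphic_on unit_disk \<and> integrable \<mu> (\<lambda>z. norm (f z) powr p)}"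

(* A Bochner integral is 0 for a non-integrable function, so this value is meaningful
   only for f in the Bergman space. For p < 1 it is only a quasi-norm. *)
definition bergman_norm :: "real \<Rightarrow> complex measure \<Rightarrow> (complex \<Rightarrow> complex) \<Rightarrow> real" where
  "bergman_norm p \<mu> f = (\<integral>z. norm (f z) powr p \<partial>\<mu>) powr (1 / p)"

(* The membership condition on f - Q says that its norm is finite. *)
definition polynomials_dense :: "real \<Rightarrow> complex measure \<Rightarrow> bool" where
  "polynomials_dense p \<mu> \<longleftrightarrow>
     (\<forall>f\<in>bergman_space p \<mu>. \<forall>\<epsilon>>0. \<exists>Q :: complex poly.
        (\<lambda>z. f z - poly Q z) \<in> bergman_space p \<mu> \<and>
        bergman_norm p \<mu> (\<lambda>z. f z - poly Q z) < \<epsilon>)"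

end

theory Submission
  imports Defs "HOL-Complex_Analysis.Cauchy_Integral_Formula"
begin

text \<open>
  A function \<open>f\<close> in the space is approximated by its dilations \<open>f\<^sub>r(z) = f(r z)\<close> with \<open>r < 1\<close>.
  Each \<open>f\<^sub>r\<close> is holomorphic across the closed unit disk, so its Taylor polynomials converge to it
  uniformly on the disk (\<open>dilate_uniformly_approx_poly\<close>), hence also in the mean, because the
  measure is finite. What remains is that \<open>f\<^sub>r\<close> tends to \<open>f\<close> in the mean as \<open>r\<close> tends to 1.

  On a disk \<open>|z| \<le> \<rho>\<close> with \<open>\<rho> < 1\<close> the convergence is uniform. The danger is in the outer annulus
  \<open>|z| > \<rho>\<close>, where the mass of \<open>f\<^sub>r\<close> could fail to be small although that of \<open>f\<close> is. This is
  where the growth condition on the weight enters. Substituting \<open>u = r z\<close> turns the mean of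
  \<open>f\<^sub>r\<close> over \<open>|z| > \<rho>\<close> into the mean of \<open>f\<close> over \<open>r \<rho> < |u| < r\<close>, with the weight \<open>w(u/r) / r\<^sup>2\<close> in
  place of \<open>w(u)\<close>; the condition bounds this new weight by \<open>C w(u) / r^(k+2)\<close>
  (\<open>nn_integral_dilation_le\<close>). So the mass of every \<open>f\<^sub>r\<close> near the circle is controlled, with
  a constant independent of \<open>r \<ge> r0\<close>, by the mass of \<open>f\<close> near the circle, and the latter is
  small by dominated convergence (\<open>small_integral_near_circle\<close>).

  For \<open>p < 1\<close> the triangle inequality fails, so the three contributions are combined at the level
  of \<open>p\<close>-th powers (\<open>powr_add3_le\<close>), which works for every \<open>p > 0\<close> at once. Integrals are taken
  in the extended nonnegative reals, so that the final estimate also yields the integrability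
  of \<open>|f - Q|\<^sup>p\<close>.
\<close>

section \<open>Dilations and the weighted measure\<close>

lemma nn_integral_lebesgue_scaleR:
  fixes f :: "'a::euclidean_space \<Rightarrow> ennreal"
  assumes "f \<in> borel_measurable lebesgue" and "c \<noteq> 0"
  shows "(\<integral>\<^sup>+x. f x \<partial>lebesgue) =
    ennreal (\<bar>c\<bar> ^ DIM('a)) * (\<integral>\<^sup>+x. f (c *\<^sub>R x) \<partial>lebesgue)"
proof -
  have scale: "(\<Sum>j\<in>Basis. (c * (x \<bullet> j)) *\<^sub>R j) = c *\<^sub>R x" for x :: 'a
    by (simp add: scaleR_sum_right[symmetric] scaleR_scaleR[symmetric] euclidean_representation
        del: scaleR_scaleR)
  have [measurable]: "(\<lambda>x::'a. c *\<^sub>R x) \<in> lebesgue \<rightarrow>\<^sub>M lebesgue"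
    by (rule lebesgue_measurable_scaling)
  have "lebesgue = density (distr lebesgue lebesgue (\<lambda>x::'a. c *\<^sub>R x)) (\<lambda>_. \<bar>c\<bar> ^ DIM('a))"
    using lebesgue_affine_euclidean[where c = "\<lambda>_. c" and t = "0 :: 'a"] assms(2)
    by (simp add: scale)
  then have "(\<integral>\<^sup>+x. f x \<partial>lebesgue) =
      (\<integral>\<^sup>+x. f x \<partial>density (distr lebesgue lebesgue (\<lambda>x::'a. c *\<^sub>R x)) (\<lambda>_. \<bar>c\<bar> ^ DIM('a)))"
    by simp
  also have "\<dots> = ennreal (\<bar>c\<bar> ^ DIM('a)) * (\<integral>\<^sup>+x. f (c *\<^sub>R x) \<partial>lebesgue)"
    using assms(1) by (simp add: nn_integral_density nn_integral_distr nn_integral_cmult)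
  finally show ?thesis .
qed

lemma nn_integral_weighted_measure:
  assumes [measurable]: "w \<in> borel_measurable (lebesgue_on unit_disk)"
    "h \<in> borel_measurable (lebesgue_on unit_disk)"
  shows "(\<integral>\<^sup>+z. h z \<partial>weighted_measure w) =
    (\<integral>\<^sup>+z. ennreal (w z) * h z * indicator unit_disk z \<partial>lebesgue)"
  unfolding weighted_measure_def
  by (simp add: nn_integral_density nn_integral_restrict_space)

text \<open>
  Of the exponent \<open>k + 2\<close>, the part \<open>k\<close> comes from the growth condition and the part 2 is the
  Jacobian of \<open>u = r z\<close> in the plane. The integral over the unit disk becomes one over \<open>|u| < r\<close>,
  which is exactly where the growth condition applies; the bound then forgets this restriction.
  Taking for \<open>h\<close> a function cut off to an annulus localizes the estimate near the circle.
\<close>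
lemma nn_integral_dilation_le:
  fixes w :: "complex \<Rightarrow> real" and h :: "complex \<Rightarrow> ennreal"
  assumes w [measurable]: "w \<in> borel_measurable (lebesgue_on unit_disk)"
    and h [measurable]: "h \<in> borel_measurable (lebesgue_on unit_disk)"
    and w_nonneg: "\<And>z. z \<in> unit_disk \<Longrightarrow> 0 \<le> w z"
    and r: "0 < r" "r < 1"
    and le: "\<And>z. norm z < r \<Longrightarrow> r ^ k * w (z / complex_of_real r) \<le> C * w z"
  shows "(\<integral>\<^sup>+z. h (complex_of_real r * z) \<partial>weighted_measure w)
    \<le> ennreal (C / r ^ (k + 2)) * (\<integral>\<^sup>+z. h z \<partial>weighted_measure w)"
proof -
  \<comment> \<open>Cutting off at the unit disk makes both factors measurable on the whole plane, where the
    change of variables takes place, and makes \<open>W(u / r)\<close> vanish for \<open>|u| \<ge> r\<close>.\<close>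
  define W where "W = (\<lambda>z. ennreal (w z) * indicator unit_disk z)"
  define H where "H = (\<lambda>z. h z * indicator unit_disk z)"
  have W [measurable]: "W \<in> borel_measurable lebesgue"
    unfolding W_def using w
    by (subst borel_measurable_restrict_space_iff_ennreal[symmetric]) auto
  have H [measurable]: "H \<in> borel_measurable lebesgue"
    unfolding H_def using h
    by (subst borel_measurable_restrict_space_iff_ennreal[symmetric]) auto
  have scale [measurable]: "(\<lambda>x::complex. c *\<^sub>R x) \<in> lebesgue \<rightarrow>\<^sub>M lebesgue" for c
    by (rule lebesgue_measurable_scaling)
  have Wr: "(\<lambda>u. W ((1/r) *\<^sub>R u)) \<in> borel_measurable lebesgue"
    using measurable_compose[OF scale W] .
  have Hr: "(\<lambda>u. H (r *\<^sub>R u)) \<in> borel_measurable lebesgue"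
    using measurable_compose[OF scale H] .
  have meas: "(\<lambda>u. W ((1/r) *\<^sub>R u) * H u) \<in> borel_measurable lebesgue"
    using Wr by measurable
  have disk: "r *\<^sub>R z \<in> unit_disk" if "z \<in> unit_disk" for z :: complex
    using that r mult_strict_mono[of r 1 "norm z" 1] by simp
  have hr: "(\<lambda>z. h (complex_of_real r * z)) \<in> borel_measurable (lebesgue_on unit_disk)"
  proof -
    have "(\<lambda>u. H (r *\<^sub>R u)) \<in> borel_measurable (lebesgue_on unit_disk)"
      using Hr by (rule measurable_restrict_space1)
    then show ?thesis
      by (rule measurable_cong[THEN iffD1, rotated])
        (use disk in \<open>auto simp: H_def scaleR_conv_of_real\<close>)
  qed
  have "(\<integral>\<^sup>+z. h (complex_of_real r * z) \<partial>weighted_measure w)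
      = (\<integral>\<^sup>+z. W ((1/r) *\<^sub>R (r *\<^sub>R z)) * H (r *\<^sub>R z) \<partial>lebesgue)"
    unfolding nn_integral_weighted_measure[OF w hr]
    by (intro nn_integral_cong)
      (use disk r in \<open>auto simp: W_def H_def scaleR_conv_of_real indicator_def\<close>)
  also have "\<dots> = ennreal (1 / r\<^sup>2) * (ennreal (r\<^sup>2) * \<dots>)"
    using r by (simp add: mult.assoc[symmetric] ennreal_mult[symmetric] del: scaleR_scaleR)
  also have "ennreal (r\<^sup>2) * (\<integral>\<^sup>+z. W ((1/r) *\<^sub>R (r *\<^sub>R z)) * H (r *\<^sub>R z) \<partial>lebesgue)
      = (\<integral>\<^sup>+u. W ((1/r) *\<^sub>R u) * H u \<partial>lebesgue)"
    using nn_integral_lebesgue_scaleR[OF meas, of r] r by simp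
  also have "\<dots> \<le> (\<integral>\<^sup>+u. ennreal (C / r ^ k) * (W u * H u) \<partial>lebesgue)"
  proof (intro nn_integral_mono)
    fix u :: complex
    show "W ((1/r) *\<^sub>R u) * H u \<le> ennreal (C / r ^ k) * (W u * H u)"
    proof (cases "norm u < r")
      case True
      then have u: "u \<in> unit_disk"
        using r by simp
      have "w ((1/r) *\<^sub>R u) \<le> C / r ^ k * w u"
        using le[OF True] r by (simp add: field_simps scaleR_conv_of_real)
      then have "ennreal (w ((1/r) *\<^sub>R u)) \<le> ennreal (C / r ^ k) * ennreal (w u)"
        using w_nonneg[OF u] by (simp add: ennreal_mult''[symmetric] ennreal_leI)
      then have "W ((1/r) *\<^sub>R u) \<le> ennreal (C / r ^ k) * W u"
        using u by (auto simp: W_def indicator_def)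
      then show ?thesis
        by (metis mult.assoc mult_right_mono zero_le)
    next
      case False
      then have "(1/r) *\<^sub>R u \<notin> unit_disk"
        using r by (simp add: field_simps)
      then show ?thesis
        by (simp add: W_def)
    qed
  qed
  also have "\<dots> = ennreal (C / r ^ k) * (\<integral>\<^sup>+z. h z \<partial>weighted_measure w)"
    unfolding nn_integral_weighted_measure[OF w h]
    by (subst nn_integral_cmult, measurable)
      (auto intro!: arg_cong[where f = "\<lambda>x. _ * x"] nn_integral_cong simp: W_def H_def indicator_def)
  also have "ennreal (1 / r\<^sup>2) * (ennreal (C / r ^ k) * (\<integral>\<^sup>+z. h z \<partial>weighted_measure w))
      = ennreal (C / r ^ (k + 2)) * (\<integral>\<^sup>+z. h z \<partial>weighted_measure w)"
  proof -
    have "ennreal (1 / r\<^sup>2) * ennreal (C / r ^ k) = ennreal (1 / r\<^sup>2 * (C / r ^ k))"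
      by (rule ennreal_mult'[symmetric]) simp
    also have "1 / r\<^sup>2 * (C / r ^ k) = C / r ^ (k + 2)"
      by (simp add: power_add power2_eq_square)
    finally show ?thesis
      by (simp only: mult.assoc[symmetric])
  qed
  finally show ?thesis
    by (simp add: mult_left_mono)
qed

section \<open>Polynomial approximation of a dilation\<close>

text \<open>
  The Taylor series of \<open>f\<close> at 0 converges at a point \<open>s\<close> with \<open>r < s < 1\<close>, hence absolutely at \<open>r\<close>;
  the terms at \<open>r\<close> then majorize those at all \<open>r z\<close> with \<open>|z| < 1\<close>.
\<close>
lemma dilate_uniformly_approx_poly:
  fixes f :: "complex \<Rightarrow> complex"
  assumes f: "f holomorphic_on unit_disk" and r: "0 < r" "r < 1" and "0 < e"
  obtains Q :: "complex poly"
  where "\<And>z. norm z < 1 \<Longrightarrow> norm (f (complex_of_real r * z) - poly Q z) < e"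
proof -
  define a where "a = (\<lambda>n. (deriv ^^ n) f 0 / fact n)"
  have a: "(\<lambda>n. a n * z ^ n) sums f z" if "z \<in> unit_disk" for z
    using holomorphic_power_series[OF f that] by (simp add: a_def)
  obtain s where s: "r < s" "s < 1"
    using dense r by blast
  have "summable (\<lambda>n. a n * complex_of_real s ^ n)"
    using a[of "complex_of_real s"] r s by (auto simp: sums_iff)
  then have "summable (\<lambda>n. norm (a n * complex_of_real r ^ n))"
    using powser_insidea[of a "complex_of_real s" "complex_of_real r"] r s by simp
  then have "uniform_limit unit_disk (\<lambda>n z. \<Sum>i<n. a i * (complex_of_real r * z) ^ i)
      (\<lambda>z. \<Sum>i. a i * (complex_of_real r * z) ^ i) sequentially"
  proof (rule Weierstrass_m_test[rotated])
    fix n and z :: complex assume "z \<in> unit_disk"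
    then have "norm z ^ n \<le> 1"
      by (simp add: power_le_one)
    then show "norm (a n * (complex_of_real r * z) ^ n) \<le> norm (a n * complex_of_real r ^ n)"
      using r by (auto simp: norm_mult norm_power power_mult_distrib mult_left_le intro!: mult_left_mono)
  qed
  then obtain N where N: "\<And>z. z \<in> unit_disk \<Longrightarrow>
      dist (\<Sum>i<N. a i * (complex_of_real r * z) ^ i) (\<Sum>i. a i * (complex_of_real r * z) ^ i) < e"
    using \<open>0 < e\<close> unfolding uniform_limit_iff eventually_sequentially by (metis order_refl)
  define Q where "Q = (\<Sum>i<N. monom (a i * complex_of_real r ^ i) i)"
  show ?thesis
  proof
    fix z :: complex assume z: "norm z < 1"
    have "complex_of_real r * z \<in> unit_disk"
      using z r mult_strict_mono[of r 1 "norm z" 1] by (simp add: norm_mult)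
    then have "(\<Sum>i. a i * (complex_of_real r * z) ^ i) = f (complex_of_real r * z)"
      using a sums_unique by metis
    moreover have "(\<Sum>i<N. a i * (complex_of_real r * z) ^ i) = poly Q z"
      by (simp add: Q_def poly_sum poly_monom power_mult_distrib mult.assoc)
    ultimately show "norm (f (complex_of_real r * z) - poly Q z) < e"
      using N[of z] z by (simp add: dist_norm norm_minus_commute)
  qed
qed

section \<open>Estimates for the mean\<close>

text \<open>
  The sum is at most three times its largest term. The constant is not sharp, but it
  serves \<open>p < 1\<close> and \<open>p \<ge> 1\<close> alike.
\<close>
lemma powr_add3_le:
  fixes a b c p :: real
  assumes "0 \<le> a" "0 \<le> b" "0 \<le> c" "0 < p"
  shows "(a + b + c) powr p \<le> 3 powr p * (a powr p + b powr p + c powr p)"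
proof -
  define m where "m = max a (max b c)"
  have "(a + b + c) powr p \<le> (3 * m) powr p"
    using assms by (intro powr_mono2) (auto simp: m_def)
  also have "\<dots> = 3 powr p * m powr p"
    by (rule powr_mult)
  also have "\<dots> \<le> 3 powr p * (a powr p + b powr p + c powr p)"
    using assms by (intro mult_left_mono) (auto simp: m_def max_def)
  finally show ?thesis .
qed

text \<open>
  The annuli \<open>1 - 1/(n+2) < |z| < 1\<close> decrease to the empty set, so the integrals over them tend
  to 0, the integrand being dominated by \<open>g\<close>. The shift by 2 makes the inner radius positive.
\<close>
lemma small_integral_near_circle:
  fixes g :: "complex \<Rightarrow> real"
  assumes g: "integrable \<mu> g" and nonneg: "\<And>z. 0 \<le> g z"
    and space: "space \<mu> = unit_disk" and sets: "sets \<mu> = sets (lebesgue_on unit_disk)"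
    and "0 < t"
  obtains s where "0 < s" "s < 1"
    "(\<integral>\<^sup>+z. ennreal (g z) * indicator {z. s < norm z} z \<partial>\<mu>) < ennreal t"
proof -
  have [measurable]: "g \<in> borel_measurable \<mu>"
    using g by simp
  have out [measurable]: "{z \<in> space \<mu>. c < norm z} \<in> sets \<mu>" for c :: real
  proof -
    have "{z :: complex. c < norm z} \<in> sets lebesgue"
      by (simp add: borel_open open_Collect_less continuous_intros)
    then show ?thesis
      unfolding space sets sets_restrict_space by (auto simp: image_iff)
  qed
  have meas: "(\<lambda>z. ennreal (g z) * indicator {z. c < norm z} z) \<in> borel_measurable \<mu>" for c
    by measurable
  have "(\<lambda>n. \<integral>\<^sup>+z. ennreal (g z) * indicator {z. 1 - 1 / real (Suc (Suc n)) < norm z} z \<partial>\<mu>)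
      \<longlonglongrightarrow> (\<integral>\<^sup>+z. 0 \<partial>\<mu>)"
  proof (rule nn_integral_dominated_convergence[where w = "\<lambda>z. ennreal (g z)"])
    show "AE z in \<mu>. (\<lambda>n. ennreal (g z) * indicator {z. 1 - 1 / real (Suc (Suc n)) < norm z} z) \<longlonglongrightarrow> 0"
    proof (rule AE_I2)
      fix z assume "z \<in> space \<mu>"
      then have "norm z < 1"
        using space by simp
      moreover have "(\<lambda>n. 1 - 1 / real (Suc (Suc n))) \<longlonglongrightarrow> 1"
        using tendsto_diff[OF tendsto_const LIMSEQ_Suc[OF LIMSEQ_inverse_real_of_nat], of "1::real"]
        by (simp add: inverse_eq_divide)
      ultimately have "\<forall>\<^sub>F n in sequentially. norm z < 1 - 1 / real (Suc (Suc n))"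
        by (metis order_tendstoD(1))
      then have "\<forall>\<^sub>F n in sequentially.
          ennreal (g z) * indicator {z. 1 - 1 / real (Suc (Suc n)) < norm z} z = 0"
        by eventually_elim (auto simp: indicator_def)
      then show "(\<lambda>n. ennreal (g z) * indicator {z. 1 - 1 / real (Suc (Suc n)) < norm z} z) \<longlonglongrightarrow> 0"
        by (rule tendsto_eventually)
    qed
    show "(\<integral>\<^sup>+z. ennreal (g z) \<partial>\<mu>) < \<infinity>"
      using g nonneg by (simp add: integrable_iff_bounded)
  qed (use meas in \<open>auto simp: indicator_def\<close>)
  then have "\<forall>\<^sub>F n in sequentially.
      (\<integral>\<^sup>+z. ennreal (g z) * indicator {z. 1 - 1 / real (Suc (Suc n)) < norm z} z \<partial>\<mu>) < ennreal t"
    using \<open>0 < t\<close> by (intro order_tendstoD(2)) auto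
  then obtain n where
    "(\<integral>\<^sup>+z. ennreal (g z) * indicator {z. 1 - 1 / real (Suc (Suc n)) < norm z} z \<partial>\<mu>) < ennreal t"
    by (auto simp: eventually_sequentially)
  then show thesis
    by (intro that[of "1 - 1 / real (Suc (Suc n))"]) (auto simp: field_simps)
qed

section \<open>Density of the polynomials\<close>

theorem theorem2p1:
  fixes p r0 C :: real and k :: nat and w :: "complex \<Rightarrow> real"
  assumes "0 < p"
    and "weight_function w"
    and "finite_measure (weighted_measure w)"
    and "0 < r0" and "r0 < 1"
    and "\<And>r z. r0 \<le> r \<Longrightarrow> r < 1 \<Longrightarrow> norm z < r \<Longrightarrow>
           r ^ k * w (z / complex_of_real r) \<le> C * w z"
  shows "polynomials_dense p (weighted_measure w)"
  unfolding polynomials_dense_def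
proof (intro ballI allI impI)
  fix f :: "complex \<Rightarrow> complex" and \<epsilon> :: real
  assume fb: "f \<in> bergman_space p (weighted_measure w)" and "0 < \<epsilon>"
  define \<mu> where "\<mu> = weighted_measure w"
  have f: "f holomorphic_on unit_disk" and fint: "integrable \<mu> (\<lambda>z. norm (f z) powr p)"
    using fb by (auto simp: bergman_space_def \<mu>_def)
  have wpos: "\<And>z. z \<in> unit_disk \<Longrightarrow> 0 < w z"
    and w: "w \<in> borel_measurable (lebesgue_on unit_disk)"
    using assms(2) by (auto simp: weight_function_def)
  have space: "space \<mu> = unit_disk" and sets: "sets \<mu> = sets (lebesgue_on unit_disk)"
    by (auto simp: \<mu>_def weighted_measure_def)
  interpret finite_measure \<mu>
    using assms(3) by (simp add: \<mu>_def)
  define M where "M = measure \<mu> (space \<mu>)"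
  have "0 \<le> M" and M: "emeasure \<mu> (space \<mu>) = ennreal M"
    by (auto simp: M_def emeasure_eq_measure)
  have "0 < C"
  proof -
    have "r0 ^ k * w 0 \<le> C * w 0"
      using assms(4,5) assms(6)[of r0 0] by simp
    moreover have "0 < r0 ^ k * w 0"
      using assms(4) wpos[of 0] by simp
    ultimately have "0 < C * w 0"
      by linarith
    then show ?thesis
      using wpos[of 0] by (simp add: zero_less_mult_iff)
  qed
  \<comment> \<open>Bounds the factor \<open>C / r^(k+2)\<close> of the dilation estimate for all \<open>r \<ge> r0\<close>.\<close>
  define K where "K = C / r0 ^ (k + 2)"
  have "0 < K"
    using \<open>0 < C\<close> assms(4) by (simp add: K_def)
  \<comment> \<open>With \<open>t\<close> the allowed mass of \<open>f\<close> near the circle and \<open>\<eta>\<close> the allowed uniform error, the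
    mean of \<open>|f - Q|\<^sup>p\<close> will come out as at most \<open>3\<^sup>p (\<eta>\<^sup>p M + t + K t) \<le> 3\<^sup>p (\<delta>/4 + \<delta>/4)\<close>, which
    is half of \<open>\<epsilon>\<^sup>p\<close>. Dividing by \<open>1 + M\<close> instead of \<open>M\<close> covers \<open>M = 0\<close>.\<close>
  define \<delta> where "\<delta> = \<epsilon> powr p / 3 powr p"
  have "0 < \<delta>"
    using \<open>0 < \<epsilon>\<close> by (simp add: \<delta>_def)
  define t where "t = \<delta> / (4 * (1 + K))"
  have "0 < t" and t: "(1 + K) * t = \<delta> / 4"
    using \<open>0 < \<delta>\<close> \<open>0 < K\<close> by (simp_all add: t_def field_simps)
  define \<eta> where "\<eta> = (\<delta> / (4 * (1 + M))) powr (1 / p)"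
  have "0 < \<eta>"
    using \<open>0 < \<delta>\<close> \<open>0 \<le> M\<close> by (simp add: \<eta>_def)
  have "\<eta> powr p = \<delta> / (4 * (1 + M))"
    using \<open>0 < \<delta>\<close> \<open>0 \<le> M\<close> assms(1) by (simp add: \<eta>_def powr_powr)
  then have "\<eta> powr p * M + \<eta> powr p = \<delta> / 4"
    using \<open>0 \<le> M\<close> by (simp add: field_simps)
  then have \<eta>: "\<eta> powr p * M \<le> \<delta> / 4"
    using powr_ge_zero[of \<eta> p] by linarith
  obtain s where s: "0 < s" "s < 1"
    and small: "(\<integral>\<^sup>+z. ennreal (norm (f z) powr p) * indicator {z. s < norm z} z \<partial>\<mu>) < ennreal t"
    using small_integral_near_circle[OF fint _ space sets \<open>0 < t\<close>] by auto
  \<comment> \<open>A gap between \<open>s\<close> and \<open>\<rho>\<close> is left so that dilation by an \<open>r\<close> close to 1 maps the annulus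
    \<open>\<rho> < |z| < 1\<close> into \<open>s < |u| < 1\<close>, where \<open>f\<close> has little mass.\<close>
  obtain \<rho> where \<rho>: "s < \<rho>" "\<rho> < 1"
    using dense s by blast
  have "uniformly_continuous_on (cball 0 \<rho>) f"
    using f \<rho> by (intro compact_uniformly_continuous continuous_on_subset[OF holomorphic_on_imp_continuous_on[OF f]]) auto
  then obtain d where "0 < d"
    and d: "\<And>x y. x \<in> cball 0 \<rho> \<Longrightarrow> y \<in> cball 0 \<rho> \<Longrightarrow> dist y x < d \<Longrightarrow> dist (f y) (f x) < \<eta>"
    using \<open>0 < \<eta>\<close> unfolding uniformly_continuous_on_def by metis
  obtain r where r: "max (max r0 (s / \<rho>)) (1 - d) < r" "r < 1"
    using dense[of "max (max r0 (s / \<rho>)) (1 - d)" 1] assms(5) \<rho> s \<open>0 < d\<close> by auto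
  then have r': "0 < r" "r0 < r" "s < r * \<rho>" "1 - r < d"
    using assms(4) \<rho> s by (auto simp: field_simps)
  have close: "norm (f z - f (complex_of_real r * z)) < \<eta>" if "norm z \<le> \<rho>" for z
  proof -
    have "norm (complex_of_real r * z) \<le> \<rho>"
      using that r r' mult_mono[of r 1 "norm z" \<rho>] by (simp add: norm_mult)
    moreover have "dist z (complex_of_real r * z) < d"
    proof -
      have "z - complex_of_real r * z = complex_of_real (1 - r) * z"
        by (simp add: algebra_simps)
      then have "dist z (complex_of_real r * z) = (1 - r) * norm z"
        using r by (simp add: dist_norm norm_mult del: of_real_diff)
      also have "\<dots> \<le> 1 - r"
        using that r \<rho> by (simp add: mult_left_le)
      finally show ?thesis
        using r' by simp
    qed
    ultimately show ?thesis
      using d[of "complex_of_real r * z" z] that by (simp add: dist_norm)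
  qed
  obtain Q where Q: "\<And>z. norm z < 1 \<Longrightarrow> norm (f (complex_of_real r * z) - poly Q z) < \<eta>"
    using dilate_uniformly_approx_poly[OF f r'(1) r(2) \<open>0 < \<eta>\<close>] by blast

  \<comment> \<open>The part of \<open>|f|\<^sup>p\<close> near the circle; by the choice of \<open>r\<close>, the function \<open>h(r z)\<close> contains
    the part of \<open>|f\<^sub>r|\<^sup>p\<close> over \<open>|z| > \<rho>\<close>.\<close>
  define h where "h = (\<lambda>z. ennreal (norm (f z) powr p) * indicator {z. s < norm z} z)"
  have cont_meas: "g \<in> borel_measurable \<mu>" if "continuous_on unit_disk g" for g :: "complex \<Rightarrow> complex"
    unfolding measurable_cong_sets[OF sets refl]
    using that by (intro continuous_imp_measurable_on_sets_lebesgue) auto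
  have norm_meas [measurable]: "(\<lambda>z::complex. norm z) \<in> borel_measurable \<mu>"
    using cont_meas[of "\<lambda>z. z"] by measurable
  have f_cont: "continuous_on unit_disk f"
    using f by (rule holomorphic_on_imp_continuous_on)
  have f_meas [measurable]: "f \<in> borel_measurable \<mu>"
    using f_cont by (rule cont_meas)
  have fQ_meas: "(\<lambda>z. f z - poly Q z) \<in> borel_measurable \<mu>"
    by (intro cont_meas continuous_intros f_cont)
  have h_meas [measurable]: "h \<in> borel_measurable \<mu>"
    unfolding h_def by measurable
  have h_meas': "h \<in> borel_measurable (lebesgue_on unit_disk)"
    using h_meas unfolding measurable_cong_sets[OF sets refl] .
  have hr_meas [measurable]: "(\<lambda>z. h (complex_of_real r * z)) \<in> borel_measurable \<mu>"
  proof -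
    have disk: "complex_of_real r * z \<in> unit_disk" if "z \<in> unit_disk" for z
      using that r r' mult_strict_mono[of r 1 "norm z" 1] by (simp add: norm_mult)
    have [measurable]: "(\<lambda>z. f (complex_of_real r * z)) \<in> borel_measurable \<mu>"
      using disk by (intro cont_meas continuous_on_compose2[OF f_cont] continuous_intros) auto
    have "(\<lambda>z. h (complex_of_real r * z)) =
        (\<lambda>z. ennreal (norm (f (complex_of_real r * z)) powr p) * indicator {z. s < r * norm z} z)"
      using r' by (auto simp: h_def norm_mult indicator_def)
    then show ?thesis
      by simp
  qed

  have h_small: "(\<integral>\<^sup>+z. h z \<partial>\<mu>) \<le> ennreal t"
    using small by (simp add: h_def)
  have "(\<integral>\<^sup>+z. h (complex_of_real r * z) \<partial>\<mu>) \<le> ennreal (C / r ^ (k + 2)) * (\<integral>\<^sup>+z. h z \<partial>\<mu>)"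
    unfolding \<mu>_def
    using nn_integral_dilation_le[OF w h_meas' _ r'(1) r(2), of k C] assms(6)[of r] r r' wpos
    by (simp add: less_imp_le)
  also have "\<dots> \<le> ennreal K * ennreal t"
  proof (intro mult_mono h_small ennreal_leI)
    show "C / r ^ (k + 2) \<le> K"
      unfolding K_def using \<open>0 < C\<close> r r' assms(4)
      by (intro divide_left_mono power_mono) auto
  qed auto
  finally have hr_small: "(\<integral>\<^sup>+z. h (complex_of_real r * z) \<partial>\<mu>) \<le> ennreal (K * t)"
    using \<open>0 < K\<close> \<open>0 < t\<close> by (simp add: ennreal_mult)

  have pointwise: "ennreal (norm (f z - poly Q z) powr p)
      \<le> ennreal (3 powr p) * (ennreal (\<eta> powr p) + h z + h (complex_of_real r * z))"
    if z: "norm z < 1" for z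
  proof (cases "norm z \<le> \<rho>")
    case True
    have "norm (f z - poly Q z) \<le> norm (f z - f (complex_of_real r * z)) + norm (f (complex_of_real r * z) - poly Q z)"
      by (metis diff_add_cancel diff_add_eq norm_triangle_ineq add_diff_eq)
    \<comment> \<open>The factor 2 would do; 3 gives the same constant \<open>3\<^sup>p\<close> as on the outer annulus.\<close>
    also have "\<dots> \<le> 3 * \<eta>"
      using close[OF True] Q[OF z] \<open>0 < \<eta>\<close> by linarith
    finally have "norm (f z - poly Q z) powr p \<le> (3 * \<eta>) powr p"
      using assms(1) by (intro powr_mono2) auto
    also have "\<dots> = 3 powr p * \<eta> powr p"
      using \<open>0 < \<eta>\<close> by (simp add: powr_mult)
    finally have "ennreal (norm (f z - poly Q z) powr p) \<le> ennreal (3 powr p) * ennreal (\<eta> powr p)"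
      by (simp add: ennreal_mult[symmetric] ennreal_leI)
    also have "\<dots> \<le> ennreal (3 powr p) * (ennreal (\<eta> powr p) + h z + h (complex_of_real r * z))"
      by (intro mult_left_mono) (auto simp: add.assoc)
    finally show ?thesis .
  next
    case False
    have "s < r * norm z"
      using False r r' by (smt (verit) mult_left_mono)
    then have 1: "h (complex_of_real r * z) = ennreal (norm (f (complex_of_real r * z)) powr p)"
      using r' by (simp add: h_def norm_mult)
    have 2: "h z = ennreal (norm (f z) powr p)"
      using False \<rho> by (simp add: h_def)
    have "norm (f z - poly Q z) \<le> norm (f z) + norm (f (complex_of_real r * z)) + norm (f (complex_of_real r * z) - poly Q z)"
      using norm_triangle_ineq4[of "f z" "f (complex_of_real r * z)"]
        norm_triangle_ineq[of "f z - f (complex_of_real r * z)" "f (complex_of_real r * z) - poly Q z"]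
      by simp
    also have "\<dots> \<le> \<eta> + norm (f z) + norm (f (complex_of_real r * z))"
      using Q[OF z] by linarith
    finally have "norm (f z - poly Q z) powr p \<le> (\<eta> + norm (f z) + norm (f (complex_of_real r * z))) powr p"
      using assms(1) by (intro powr_mono2) auto
    also have "\<dots> \<le> 3 powr p * (\<eta> powr p + norm (f z) powr p + norm (f (complex_of_real r * z)) powr p)"
      using \<open>0 < \<eta>\<close> assms(1) by (intro powr_add3_le) auto
    finally show ?thesis
      unfolding 1 2 by (simp add: ennreal_mult[symmetric] ennreal_plus[symmetric] ennreal_leI del: ennreal_plus)
  qed

  have "(\<integral>\<^sup>+z. ennreal (norm (f z - poly Q z) powr p) \<partial>\<mu>)
      \<le> (\<integral>\<^sup>+z. ennreal (3 powr p) * (ennreal (\<eta> powr p) + h z + h (complex_of_real r * z)) \<partial>\<mu>)"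
    using pointwise space by (intro nn_integral_mono) auto
  also have "\<dots> = ennreal (3 powr p) * (ennreal (\<eta> powr p) * ennreal M + (\<integral>\<^sup>+z. h z \<partial>\<mu>)
      + (\<integral>\<^sup>+z. h (complex_of_real r * z) \<partial>\<mu>))"
    by (simp add: nn_integral_cmult nn_integral_add M)
  also have "\<dots> \<le> ennreal (3 powr p) * (ennreal (\<eta> powr p) * ennreal M + ennreal t + ennreal (K * t))"
    by (intro mult_left_mono add_mono h_small hr_small) auto
  also have "\<dots> = ennreal (3 powr p * (\<eta> powr p * M + t + K * t))"
    using \<open>0 \<le> M\<close> \<open>0 < t\<close> \<open>0 < K\<close>
    by (simp add: ennreal_mult[symmetric] ennreal_plus[symmetric] del: ennreal_plus)
  also have "\<dots> \<le> ennreal (3 powr p * (\<delta> / 2))"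
    using \<eta> t by (intro ennreal_leI mult_left_mono) (auto simp: algebra_simps)
  also have "\<dots> = ennreal (\<epsilon> powr p / 2)"
    by (simp add: \<delta>_def)
  finally have bound: "(\<integral>\<^sup>+z. ennreal (norm (f z - poly Q z) powr p) \<partial>\<mu>) \<le> ennreal (\<epsilon> powr p / 2)" .
  have int: "integrable \<mu> (\<lambda>z. norm (f z - poly Q z) powr p)"
    using bound fQ_meas by (intro integrableI_bounded) (auto intro: le_less_trans)
  have "ennreal (\<integral>z. norm (f z - poly Q z) powr p \<partial>\<mu>) \<le> ennreal (\<epsilon> powr p / 2)"
    using bound nn_integral_eq_integral[OF int] by simp
  then have "(\<integral>z. norm (f z - poly Q z) powr p \<partial>\<mu>) \<le> \<epsilon> powr p / 2"
    by (subst (asm) ennreal_le_iff) auto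
  also have "\<dots> < \<epsilon> powr p"
    using \<open>0 < \<epsilon>\<close> by simp
  finally have "(\<integral>z. norm (f z - poly Q z) powr p \<partial>\<mu>) < \<epsilon> powr p" .
  then have "bergman_norm p \<mu> (\<lambda>z. f z - poly Q z) < (\<epsilon> powr p) powr (1 / p)"
    unfolding bergman_norm_def using assms(1) by (intro powr_less_mono2) auto
  also have "\<dots> = \<epsilon>"
    using \<open>0 < \<epsilon>\<close> assms(1) by (simp add: powr_powr)
  finally have "bergman_norm p \<mu> (\<lambda>z. f z - poly Q z) < \<epsilon>" .
  moreover have "(\<lambda>z. f z - poly Q z) \<in> bergman_space p \<mu>"
    unfolding bergman_space_def using int f by (auto intro!: holomorphic_intros)
  ultimately show "\<exists>Q :: complex poly. (\<lambda>z. f z - poly Q z) \<in> bergman_space p (weighted_measure w) \<and>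
      bergman_norm p (weighted_measure w) (\<lambda>z. f z - poly Q z) < \<epsilon>"
    unfolding \<mu>_def by blast
qed

end
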